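(* Let $k$ be a positive integer. (1) Let $t\ge 2$ be an integer, $D=\{t^i: i\in\mathbb{N}\}$, and let $M\subseteq\mathbb{N}$ contain at most one element of every residue class modulo $t$. Then $m_{D,M}(k)\le |M|\,(m_{\mathcal{B}}(k)-1)+1$. (2) Let $k\ge 2$, let $p,q>1$ be coprime integers and $D=\{p^iq^j: i,j\in\mathbb{N}\}$. Then $m_{D,\{0\}}(k)=\infty$.
   Context: $\mathbb{N}$ denotes the natural numbers including $0$. For $D,M\subseteq\mathbb{N}$, $\mathcal{A}_{D,M}$ is the family of hypergraphs $A$ with finite vertex set $S\subseteq\mathbb{N}$ each of whose edges has the form $\{a+nd: 0\le n\le \ell\}\cap S$, where $\ell\in\mathbb{N}$, $d\in D$ and $a\in\mathbb{N}$ are such that $a-md\in M$ for some $m\in\mathbb{N}$ (intersection of $S$ with a finite arithmetic progression with difference in $D$ which, extended backwards, meets $M$). The family $\mathcal{B}$ consists of hypergraphs $H=(V,E)$ with $V\subset\mathbb{R}^2$ finite and every edge of the form $\{(x,y)\in V: x_0<x<x_1,\ y<y_0\}$ for some $x_0,x_1,y_0\in\mathbb{R}$ (bottomless rectangles). A polychromatic $k$-coloring of a hypergraph is a coloring of its vertices with $k$ colors such that every edge contains a vertex of each color. $H_{\ge m}$ is obtained from $H$ by deleting all edges of size less than $m$. For a hypergraph family $\mathcal{H}$, $m_{\mathcal{H}}(k)$ is the smallest positive integer $m$ such that $H_{\ge m}$ has a polychromatic $k$-coloring for every $H\in\mathcal{H}$ ($\infty$ if none exists); $m_{D,M}(k):=m_{\mathcal{A}_{D,M}}(k)$.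 *)

theory Defs
  imports Complex_Main "HOL-Library.Extended_Nat" "HOL-Number_Theory.Cong"
begin

type_synonym 'a hypergraph = "'a set \<times> 'a set set"

definition verts :: "'a hypergraph \<Rightarrow> 'a set" where
  "verts H = fst H"

definition edges :: "'a hypergraph \<Rightarrow> 'a set set" where
  "edges H = snd H"

text \<open>The colors are the natural numbers below \<open>k\<close>.\<close>

definition polychromatic_coloring :: "nat \<Rightarrow> 'a hypergraph \<Rightarrow> ('a \<Rightarrow> nat) \<Rightarrow> bool" where
  "polychromatic_coloring k H c \<longleftrightarrow>
     (\<forall>v\<in>verts H. c v < k) \<and> (\<forall>e\<in>edges H. \<forall>i<k. \<exists>v\<in>e. c v = i)"

text \<open>The finiteness condition is needed because \<open>card\<close> is \<open>0\<close> on infinite sets.\<close>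

definition delete_small_edges :: "'a hypergraph \<Rightarrow> nat \<Rightarrow> 'a hypergraph" where
  "delete_small_edges H m = (verts H, {e \<in> edges H. \<not> (finite e \<and> card e < m)})"

text \<open>In \<^typ>\<open>enat\<close> the infimum of a nonempty set is its least element, and the infimum of the
  empty set is \<open>\<infinity>\<close>.\<close>

definition min_edge_size :: "'a hypergraph set \<Rightarrow> nat \<Rightarrow> enat" where
  "min_edge_size \<H> k =
     Inf {enat m | m. 0 < m \<and> (\<forall>H\<in>\<H>. \<exists>c. polychromatic_coloring k (delete_small_edges H m) c)}"

text \<open>The equation \<open>a = b + m * d\<close> with \<open>b \<in> M\<close> says that \<open>a - m * d\<close>, computed in the integers,
  lies in \<open>M\<close>; truncated subtraction on \<^typ>\<open>nat\<close> would be wrong here.\<close>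

definition AP_hypergraphs :: "nat set \<Rightarrow> nat set \<Rightarrow> nat hypergraph set" where
  "AP_hypergraphs D M =
     {H. finite (verts H) \<and>
         (\<forall>e\<in>edges H. \<exists>a l. \<exists>d\<in>D. (\<exists>m. \<exists>b\<in>M. a = b + m * d) \<and>
            e = {a + n * d | n. n \<le> l} \<inter> verts H)}"

definition bottomless_hypergraphs :: "(real \<times> real) hypergraph set" where
  "bottomless_hypergraphs =
     {H. finite (verts H) \<and>
         (\<forall>e\<in>edges H. \<exists>x0 x1 y0. e = {(x, y). (x, y) \<in> verts H \<and> x0 < x \<and> x < x1 \<and> y < y0})}"

end

theory Submission
  imports Defs "HOL-Library.Nat_Bijection"
begin

text \<open>
  (1) Split the vertices into \<open>card M\<close> classes, one for each \<open>b \<in> M\<close>: the numbers congruent to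
  \<open>b\<close> modulo \<open>t\<close>, with all remaining numbers thrown into an arbitrary class. Sending \<open>x\<close> to the
  point of abscissa \<open>x\<close> and of ordinate decreasing in the \<open>t\<close>-adic valuation of \<open>x - b\<close> turns the
  traces of progressions on a class into bottomless rectangles. Progressions of difference at
  least \<open>t\<close> stay inside one class, and for difference \<open>1\<close> the pigeonhole principle yields a class
  containing enough points.

  (2) In a complete \<open>b\<close>-ary tree whose vertices have two colors, either all children of some
  vertex have the same color or there is a monochromatic path from the root to a leaf. Writing
  the vertices as nested intervals, the path to a leaf consists of the intervals containing it,
  which is a condition on the two endpoints; these are encoded as the exponents of \<open>p\<close> and \<open>q\<close>.
  A factor coprime to \<open>p * q\<close> controls the size of the numbers, and makes siblings the elements
  of an interval of integers.
\<close>

section \<open>Powers of a single base\<close>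

text \<open>Because \<open>a\<close> lies on the progression starting at \<open>b\<close>,
  congruence to \<open>a\<close> modulo \<open>d\<close> can be replaced by congruence to
  \<open>b\<close>. Only the range then depends on \<open>a\<close>. The difference is taken in the
  integers since \<open>x\<close> may be smaller than \<open>b\<close>.\<close>

lemma AP_trace_iff:
  fixes a b d l m x :: nat
  assumes "a = b + m * d" "0 < d"
  shows "x \<in> {a + n * d | n. n \<le> l} \<longleftrightarrow> a \<le> x \<and> x \<le> a + l * d \<and> int d dvd int x - int b"
proof
  assume "x \<in> {a + n * d | n. n \<le> l}"
  then obtain n where n: "n \<le> l" "x = a + n * d" by auto
  have "int x - int b = int d * (int m + int n)"
    using n assms by (simp add: algebra_simps)
  then show "a \<le> x \<and> x \<le> a + l * d \<and> int d dvd int x - int b"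
    using n by (auto intro: mult_right_mono)
next
  assume x: "a \<le> x \<and> x \<le> a + l * d \<and> int d dvd int x - int b"
  have "int (x - a) = (int x - int b) - int m * int d"
    using x assms by simp
  then have "int d dvd int (x - a)"
    using x by (metis dvd_diff dvd_triv_right)
  then have "d dvd x - a" by simp
  then obtain n where n: "x - a = n * d" by (metis dvd_def mult.commute)
  then have "n * d \<le> l * d" using x by linarith
  then have "n \<le> l" using assms by simp
  then show "x \<in> {a + n * d | n. n \<le> l}"
    using n x by (auto intro!: exI[of _ n])
qed

lemma ex_residue_representative:
  fixes t :: nat and M :: "nat set"
  assumes "M \<noteq> {}" "\<forall>x\<in>M. \<forall>y\<in>M. [x = y] (mod t) \<longrightarrow> x = y"
  obtains f where "\<And>x. f x \<in> M" "\<And>x b. b \<in> M \<Longrightarrow> [x = b] (mod t) \<Longrightarrow> f x = b"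
proof -
  have "\<exists>c. c \<in> M \<and> (\<forall>b\<in>M. [x = b] (mod t) \<longrightarrow> c = b)" for x
  proof (cases "\<exists>b\<in>M. [x = b] (mod t)")
    case True
    then show ?thesis using assms(2) by (metis cong_sym cong_trans)
  next
    case False
    then show ?thesis using assms(1) by auto
  qed
  then show ?thesis using that by metis
qed

lemma finite_of_incongruent:
  fixes t :: nat and M :: "nat set"
  assumes "0 < t" "\<forall>x\<in>M. \<forall>y\<in>M. [x = y] (mod t) \<longrightarrow> x = y"
  shows "finite M"
proof (rule inj_on_finite)
  show "inj_on (\<lambda>x. x mod t) M"
    using assms(2) by (auto simp: inj_on_def cong_def)
  show "(\<lambda>x. x mod t) ` M \<subseteq> {..<t}" using assms(1) by auto
qed simp

text \<open>Higher divisibility means lower position, so divisibility by a power of \<open>t\<close>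
  becomes lying below a line. Zero, divisible by every power, is placed below all other
  values.\<close>

definition valuation_height :: "nat \<Rightarrow> int \<Rightarrow> real" where
  "valuation_height t z = (if z = 0 then 0 else (1 / 2) ^ multiplicity (int t) z)"

text \<open>The bound \<open>2 * (1 / 2) ^ i\<close> is the height of valuation
  \<open>i - 1\<close>, so the strict inequality required by bottomless rectangles selects exactly
  the valuations from \<open>i\<close> on.\<close>

lemma valuation_height_less_iff:
  assumes "2 \<le> t"
  shows "valuation_height t z < 2 * (1 / 2) ^ i \<longleftrightarrow> int t ^ i dvd z"
proof (cases "z = 0")
  case False
  have "(1 / 2 :: real) ^ n < 2 * (1 / 2) ^ i \<longleftrightarrow> i \<le> n" for n :: nat
  proof -
    have "(1 / 2 :: real) ^ n < 2 * (1 / 2) ^ i \<longleftrightarrow> (1 / 2 :: real) ^ Suc n < (1 / 2) ^ i"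
      by (simp add: field_simps)
    also have "\<dots> \<longleftrightarrow> i < Suc n" by (rule power_strict_decreasing_iff) auto
    finally show ?thesis unfolding less_Suc_eq_le .
  qed
  moreover have "int t ^ i dvd z \<longleftrightarrow> i \<le> multiplicity (int t) z"
    using assms False by (intro power_dvd_iff_le_multiplicity) auto
  ultimately show ?thesis using False by (simp add: valuation_height_def)
qed (simp add: valuation_height_def)

lemma AP_power_coloring:
  fixes t k m :: nat and M :: "nat set"
  assumes t: "2 \<le> t" and M: "\<forall>x\<in>M. \<forall>y\<in>M. [x = y] (mod t) \<longrightarrow> x = y" "M \<noteq> {}"
    and "0 < m"
    and bottomless: "\<forall>G\<in>bottomless_hypergraphs.
          \<exists>c. polychromatic_coloring k (delete_small_edges G m) c"
    and H: "H \<in> AP_hypergraphs {t ^ i | i. True} M"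
  shows "\<exists>c. polychromatic_coloring k (delete_small_edges H (card M * (m - 1) + 1)) c"
proof -
  define S where "S = verts H"
  have finS: "finite S" using H by (simp add: AP_hypergraphs_def S_def)
  have finM: "finite M" using finite_of_incongruent[of t M] t M(1) by simp
  have cardM: "1 \<le> card M" using finM M(2) by (simp add: Suc_leI card_gt_0_iff)
  obtain rep where rep: "\<And>x. rep x \<in> M" "\<And>x b. b \<in> M \<Longrightarrow> [x = b] (mod t) \<Longrightarrow> rep x = b"
    using ex_residue_representative[OF M(2,1)] by metis
  define pt where "pt x = (real x, valuation_height t (int x - int (rep x)))" for x
  have inj_pt: "inj pt" by (auto simp: inj_def pt_def)
  define V where "V b = pt ` {x \<in> S. rep x = b}" for b
  \<comment> \<open>Every rectangle trace on the class is an edge, so one coloring per class serves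
    all edges of \<open>H\<close> at once.\<close>
  define G where "G b = (V b, {e. \<exists>x0 x1 y0.
      e = {(x, y). (x, y) \<in> V b \<and> x0 < x \<and> x < x1 \<and> y < y0}})" for b
  have "G b \<in> bottomless_hypergraphs" for b
    using finS by (auto simp: bottomless_hypergraphs_def G_def verts_def edges_def V_def)
  then have "\<forall>b. \<exists>c. polychromatic_coloring k (delete_small_edges (G b) m) c"
    using bottomless by blast
  then obtain col where col: "\<And>b. polychromatic_coloring k (delete_small_edges (G b) m) (col b)"
    by metis
  define c where "c x = col (rep x) (pt x)" for x
  have "c x < k" if "x \<in> S" for x
    using col[of "rep x"] that
    by (auto simp: polychromatic_coloring_def delete_small_edges_def verts_def G_def V_def c_def)
  moreover have "\<exists>v\<in>e. c v = j"
    if e: "e \<in> edges H" "\<not> (finite e \<and> card e < card M * (m - 1) + 1)" and j: "j < k" for e j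
  proof -
    obtain a l i n b where ab: "b \<in> M" "a = b + n * t ^ i"
      and e_eq: "e = {a + n * t ^ i | n. n \<le> l} \<inter> S"
      using H e(1) by (fastforce simp: AP_hypergraphs_def S_def)
    have e_iff: "x \<in> e \<longleftrightarrow> x \<in> S \<and> a \<le> x \<and> x \<le> a + l * t ^ i \<and> int t ^ i dvd int x - int b" for x
      unfolding e_eq using AP_trace_iff[OF ab(2), of x l] t by auto
    have fine: "finite e" using e_eq finS by simp
    \<comment> \<open>The congruence is to the representative of the class itself, as measured by
      the height in \<open>pt\<close>. For \<open>i = 0\<close> it is vacuous and these sets
      partition \<open>e\<close>; for \<open>i > 0\<close> the class of the base point of
      \<open>e\<close> already gives all of \<open>e\<close>.\<close>
    define F where "F b = {x \<in> S. rep x = b \<and> a \<le> x \<and> x \<le> a + l * t ^ i \<and>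
        int t ^ i dvd int x - int b}" for b
    have "\<exists>b'. F b' \<subseteq> e \<and> m \<le> card (F b')"
    proof (cases "i = 0")
      case True
      have sub: "F b' \<subseteq> e" for b' using True by (auto simp: F_def e_iff)
      have "e = (\<Union>b'\<in>M. F b')" using True rep(1) by (auto simp: F_def e_iff)
      then have "card e \<le> (\<Sum>b'\<in>M. card (F b'))" using card_UN_le[OF finM] by metis
      moreover have "(\<Sum>b'\<in>M. card (F b')) \<le> card M * (m - 1)"
        if "\<And>b'. card (F b') < m"
        using sum_bounded_above[of M "\<lambda>b. card (F b)" "m - 1"] that \<open>0 < m\<close>
        by (simp add: Suc_le_eq[symmetric] less_eq_Suc_le le_diff_conv2)
      ultimately show ?thesis using sub e(2) fine
        by (metis le_trans less_Suc_eq_le Suc_eq_plus1 not_le)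
    next
      case False
      have "rep x = b" if "int t ^ i dvd int x - int b" for x
      proof -
        have "int t dvd int x - int b" using that False by (meson dvd_power dvd_trans neq0_conv)
        then have "[x = b] (mod t)" by (simp add: cong_iff_dvd_diff flip: cong_int_iff)
        then show ?thesis using rep(2) ab(1) by blast
      qed
      then have "F b = e" unfolding F_def set_eq_iff e_iff mem_Collect_eq by blast
      moreover have "m \<le> card M * (m - 1) + 1"
        using mult_le_mono1[OF cardM, of "m - 1"] by linarith
      ultimately show ?thesis using e(2) fine by auto
    qed
    then obtain b' where b': "F b' \<subseteq> e" "m \<le> card (F b')" by blast
    \<comment> \<open>Rectangles have open sides, so the integer range is widened by 1 at both
      ends.\<close>
    have "pt ` F b' = {(x, y). (x, y) \<in> V b' \<and> real a - 1 < x \<and> x < real (a + l * t ^ i) + 1 \<and>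
        y < 2 * (1 / 2) ^ i}" (is "_ = ?R")
    proof -
      have iff: "pt x \<in> ?R \<longleftrightarrow> x \<in> F b'" if "x \<in> S" "rep x = b'" for x
      proof -
        have "real a - 1 < real x \<longleftrightarrow> a \<le> x" by linarith
        moreover have "real x < real (a + l * t ^ i) + 1 \<longleftrightarrow> x \<le> a + l * t ^ i" by linarith
        moreover have "pt x \<in> V b'" using that by (auto simp: V_def)
        ultimately show ?thesis
          using that valuation_height_less_iff[OF t, of "int x - int b'" i]
          by (simp add: pt_def F_def)
      qed
      show ?thesis
      proof (intro equalityI subsetI)
        fix z assume "z \<in> pt ` F b'"
        then obtain x where x: "x \<in> F b'" "z = pt x" by blast
        then have "x \<in> S" "rep x = b'" by (simp_all add: F_def)
        from iffD2[OF iff[OF this] x(1)] show "z \<in> ?R" unfolding x(2) .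
      next
        fix z assume z: "z \<in> ?R"
        then have "z \<in> V b'" by auto
        then obtain x where x: "x \<in> S" "rep x = b'" "z = pt x" by (auto simp: V_def)
        from z have "x \<in> F b'" unfolding x(3) by (rule iffD1[OF iff[OF x(1,2)]])
        then show "z \<in> pt ` F b'" unfolding x(3) by (rule imageI)
      qed
    qed
    then have "pt ` F b' \<in> edges (G b')" unfolding G_def edges_def by auto
    moreover have "card (pt ` F b') = card (F b')"
      using inj_pt by (metis card_image inj_on_subset subset_UNIV)
    ultimately have "pt ` F b' \<in> edges (delete_small_edges (G b') m)"
      using b'(2) by (simp add: delete_small_edges_def edges_def)
    moreover have "\<forall>e\<in>edges (delete_small_edges (G b') m). \<forall>i<k. \<exists>v\<in>e. col b' v = i"
      using col[of b'] unfolding polychromatic_coloring_def by (rule conjunct2)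
    ultimately have "\<exists>v\<in>pt ` F b'. col b' v = j" using j by (metis (lifting))
    then obtain x where "x \<in> F b'" "col b' (pt x) = j" by (elim bexE imageE) simp
    then show ?thesis using b'(1) by (auto simp: c_def F_def)
  qed
  ultimately have "polychromatic_coloring k (delete_small_edges H (card M * (m - 1) + 1)) c"
    by (simp add: polychromatic_coloring_def delete_small_edges_def verts_def edges_def S_def)
  then show ?thesis by blast
qed

section \<open>From colorings to least edge sizes\<close>

lemma min_edge_size_le:
  assumes "0 < m" "\<forall>H\<in>\<H>. \<exists>c. polychromatic_coloring k (delete_small_edges H m) c"
  shows "min_edge_size \<H> k \<le> enat m"
  unfolding min_edge_size_def using assms by (intro Inf_lower) auto

lemma min_edge_size_attained:
  assumes "min_edge_size \<H> k \<noteq> \<infinity>"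
  obtains m where "min_edge_size \<H> k = enat m" "0 < m"
    "\<forall>H\<in>\<H>. \<exists>c. polychromatic_coloring k (delete_small_edges H m) c"
proof -
  let ?A = "{enat m | m. 0 < m \<and> (\<forall>H\<in>\<H>. \<exists>c. polychromatic_coloring k (delete_small_edges H m) c)}"
  have "?A \<noteq> {}"
    using assms unfolding min_edge_size_def by (metis Inf_empty top_enat_def)
  then have "Inf ?A \<in> ?A" by (auto simp: Inf_enat_def intro: LeastI)
  then show ?thesis using that unfolding min_edge_size_def by blast
qed

lemma min_edge_size_AP_power_le:
  fixes t k :: nat and M :: "nat set"
  assumes "0 < k" "2 \<le> t" "\<forall>x\<in>M. \<forall>y\<in>M. [x = y] (mod t) \<longrightarrow> x = y"
  shows "min_edge_size (AP_hypergraphs {t ^ i | i. True} M) k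
      \<le> enat (card M) * (min_edge_size bottomless_hypergraphs k - 1) + 1"
proof (cases "M = {}")
  case True
  have "polychromatic_coloring k (delete_small_edges H 1) (\<lambda>_. 0)"
    if "H \<in> AP_hypergraphs {t ^ i | i. True} M" for H
    using that True \<open>0 < k\<close>
    by (auto simp: AP_hypergraphs_def polychromatic_coloring_def delete_small_edges_def edges_def)
  then have "min_edge_size (AP_hypergraphs {t ^ i | i. True} M) k \<le> enat 1"
    by (intro min_edge_size_le) auto
  then show ?thesis using True by (simp add: one_enat_def zero_enat_def[symmetric])
next
  case False
  show ?thesis
  proof (cases "min_edge_size bottomless_hypergraphs k = \<infinity>")
    case True
    \<comment> \<open>In \<open>enat\<close>, zero times infinity is zero, so the right-hand side is
      infinite only because the factor \<open>card M\<close> is nonzero.\<close>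
    have "card M \<noteq> 0" using finite_of_incongruent[of t M] assms False by auto
    then show ?thesis using True by (simp add: imult_is_infinity zero_enat_def)
  next
    case fin: False
    obtain m where m: "min_edge_size bottomless_hypergraphs k = enat m" "0 < m"
      "\<forall>G\<in>bottomless_hypergraphs. \<exists>c. polychromatic_coloring k (delete_small_edges G m) c"
      using min_edge_size_attained[OF fin] by metis
    have "min_edge_size (AP_hypergraphs {t ^ i | i. True} M) k \<le> enat (card M * (m - 1) + 1)"
      using AP_power_coloring[OF assms(2,3) False m(2,3)] by (intro min_edge_size_le) auto
    then show ?thesis by (simp add: m(1) one_enat_def)
  qed
qed

section \<open>Products of powers of two coprime bases\<close>

lemma coprime_power_prod_dvd_iff:
  fixes p q c :: nat
  assumes "1 < p" "1 < q" "coprime p q" "coprime p c" "coprime q c"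
  shows "p ^ i * q ^ j dvd p ^ u * q ^ v * c \<longleftrightarrow> i \<le> u \<and> j \<le> v"
proof
  assume dvd: "p ^ i * q ^ j dvd p ^ u * q ^ v * c"
  have "p ^ i dvd p ^ u * (q ^ v * c)"
    using dvd by (metis dvd_mult_left mult.assoc)
  moreover have "coprime (p ^ i) (q ^ v * c)" using assms by simp
  ultimately have "p ^ i dvd p ^ u" by (simp add: coprime_dvd_mult_left_iff)
  have "q ^ j dvd q ^ v * (p ^ u * c)"
    using dvd by (metis dvd_mult_right mult.assoc mult.left_commute)
  moreover have "coprime (q ^ j) (p ^ u * c)" using assms by (simp add: coprime_commute)
  ultimately have "q ^ j dvd q ^ v" by (simp add: coprime_dvd_mult_left_iff)
  show "i \<le> u \<and> j \<le> v"
    using \<open>p ^ i dvd p ^ u\<close> \<open>q ^ j dvd q ^ v\<close> assms by (meson power_dvd_imp_le)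
next
  assume "i \<le> u \<and> j \<le> v"
  then show "p ^ i * q ^ j dvd p ^ u * q ^ v * c"
    by (intro dvd_mult2 mult_dvd_mono le_imp_power_dvd) auto
qed

text \<open>A cofactor congruent to 1 modulo \<open>p * q\<close> leaves both exponents untouched,
  so it can be enlarged freely to move each number into a prescribed window between consecutive
  powers of \<open>B\<close>.\<close>

lemma ex_nat_encoding:
  fixes p q :: nat and u v r :: "'a \<Rightarrow> nat"
  assumes "finite T" "1 < p" "1 < q" "coprime p q"
  obtains f :: "'a \<Rightarrow> nat" and B :: nat where
    "\<And>x i j. x \<in> T \<Longrightarrow> p ^ i * q ^ j dvd f x \<longleftrightarrow> i \<le> u x \<and> j \<le> v x"
    "\<And>x n. x \<in> T \<Longrightarrow> B ^ n \<le> f x \<and> f x < B ^ Suc n \<longleftrightarrow> r x = n"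
proof -
  define g where "g x = p ^ u x * q ^ v x" for x
  \<comment> \<open>\<open>B\<close> exceeds every \<open>g x * (1 + p * q)\<close>, which keeps
    \<open>f x\<close> below the next power of \<open>B\<close>.\<close>
  define B where "B = (\<Sum>x\<in>T. g x) * (1 + p * q) + 1"
  define f where "f x = g x * (1 + p * q * B ^ r x)" for x
  have g_pos: "1 \<le> g x" for x using assms by (simp add: g_def Suc_le_eq)
  have B_pos: "1 \<le> B" by (simp add: B_def)
  have dvd: "p ^ i * q ^ j dvd f x \<longleftrightarrow> i \<le> u x \<and> j \<le> v x" for x i j
  proof -
    have "coprime n (1 + n * N)" for n N :: nat
      by (intro coprimeI) (metis dvd_add_left_iff dvd_mult2)
    then have "coprime p (1 + p * (q * B ^ r x))" "coprime q (1 + q * (p * B ^ r x))"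
      by blast+
    then show ?thesis
      unfolding f_def g_def using assms
      by (intro coprime_power_prod_dvd_iff) (simp_all add: ac_simps)
  qed
  have bounds: "B ^ r x \<le> f x \<and> f x < B ^ Suc (r x)" if "x \<in> T" for x
  proof
    have "1 * B ^ r x \<le> p * q * B ^ r x" using assms by (intro mult_right_mono) auto
    also have "\<dots> \<le> 1 * (1 + p * q * B ^ r x)" by simp
    also have "\<dots> \<le> f x" unfolding f_def by (intro mult_right_mono g_pos) simp
    finally show "B ^ r x \<le> f x" by simp
    have "1 + p * q * B ^ r x \<le> (1 + p * q) * B ^ r x" using B_pos by simp
    moreover have "g x \<le> (\<Sum>x\<in>T. g x)" using that assms(1) by (intro member_le_sum) auto
    ultimately have "f x \<le> (\<Sum>x\<in>T. g x) * ((1 + p * q) * B ^ r x)"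
      unfolding f_def by (intro mult_mono) auto
    also have "\<dots> < B * B ^ r x"
    proof -
      have "B * y = (\<Sum>x\<in>T. g x) * ((1 + p * q) * y) + y" for y
        unfolding B_def by (simp add: algebra_simps)
      then show ?thesis using B_pos by simp
    qed
    finally show "f x < B ^ Suc (r x)" by simp
  qed
  have "r x = n" if "x \<in> T" "B ^ n \<le> f x" "f x < B ^ Suc n" for x n
  proof -
    have "B ^ n < B ^ Suc (r x)" "B ^ r x < B ^ Suc n"
      using bounds[OF that(1)] that(2,3) by linarith+
    then have "n < Suc (r x)" "r x < Suc n"
      using B_pos power_less_imp_less_exp power_increasing by (metis not_le)+
    then show ?thesis by simp
  qed
  then show ?thesis using that[of f B] dvd bounds by blast
qed

text \<open>Greedy descent from the root. Vertex \<open>s\<close> has children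
  \<open>s * b + j\<close> with \<open>j < b\<close>, so the ancestor of \<open>s\<close> lying
  \<open>i\<close> levels higher is \<open>s div b ^ i\<close>.\<close>

lemma ex_path_same_color:
  fixes col :: "nat \<Rightarrow> nat \<Rightarrow> bool"
  assumes "\<And>h s. h < n \<Longrightarrow> s < b ^ h \<Longrightarrow> \<exists>j<b. col (Suc h) (s * b + j) = col 0 0"
  shows "h \<le> n \<Longrightarrow> \<exists>s<b ^ h. \<forall>h'\<le>h. col h' (s div b ^ (h - h')) = col 0 0"
proof (induction h)
  case (Suc h)
  then obtain s where s: "s < b ^ h" "\<forall>h'\<le>h. col h' (s div b ^ (h - h')) = col 0 0"
    by auto
  obtain j where j: "j < b" "col (Suc h) (s * b + j) = col 0 0"
    using assms[OF _ s(1)] Suc.prems by auto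
  have "(s * b + j) div b ^ (Suc h - h') = s div b ^ (h - h')" if "h' \<le> h" for h'
    using that j(1) by (simp add: Suc_diff_le div_mult2_eq)
  then have "\<forall>h'\<le>Suc h. col h' ((s * b + j) div b ^ (Suc h - h')) = col 0 0"
    using s(2) j(2) by (auto simp: le_Suc_eq)
  moreover have "s * b + j < b ^ Suc h"
  proof -
    have "s * b + j < Suc s * b" using j(1) by simp
    also have "\<dots> \<le> b ^ h * b" using s(1) by (intro mult_right_mono) auto
    finally show ?thesis by (simp add: mult.commute)
  qed
  ultimately show ?case by blast
qed simp

lemma ex_AP_hypergraph_not_polychromatic:
  fixes p q k m :: nat
  assumes k: "2 \<le> k" and pq: "1 < p" "1 < q" "coprime p q"
  shows "\<exists>H\<in>AP_hypergraphs {p ^ i * q ^ j | i j. True} {0}.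
           \<not> (\<exists>c. polychromatic_coloring k (delete_small_edges H m) c)"
proof -
  \<comment> \<open>Sibling sets must have at least \<open>m\<close> elements, and
    \<open>b > 1\<close> lets the length of an interval determine its depth, even when
    \<open>m = 0\<close>.\<close>
  define b where "b = m + 2"
  \<comment> \<open>The pair \<open>(h, s)\<close> is the vertex at depth \<open>h\<close> that stands for the interval from
    \<open>s * b ^ (m - h)\<close> to \<open>(s + 1) * b ^ (m - h)\<close>; \<open>u\<close> and \<open>v\<close> encode its two ends.\<close>
  define T where "T = (SIGMA h:{..m}. {..<b ^ h})"
  define u where "u = (\<lambda>(h, s). b ^ m - s * b ^ (m - h))"
  define v where "v = (\<lambda>(h, s). Suc s * b ^ (m - h))"
  \<comment> \<open>Depth together with the index of the parent: siblings, and only they, share a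
    window.\<close>
  define r where "r = (\<lambda>(h, s). prod_encode (h, s div b))"
  have finT: "finite T" by (simp add: T_def)
  obtain f B where f: "\<And>x i j. x \<in> T \<Longrightarrow> p ^ i * q ^ j dvd f x \<longleftrightarrow> i \<le> u x \<and> j \<le> v x"
    "\<And>x n. x \<in> T \<Longrightarrow> B ^ n \<le> f x \<and> f x < B ^ Suc n \<longleftrightarrow> r x = n"
    using ex_nat_encoding[OF finT pq, of u v r] by metis
  \<comment> \<open>This makes the truncated subtraction in \<open>u\<close> faithful.\<close>
  have left_end: "s * b ^ (m - h) \<le> b ^ m" if "h \<le> m" "s < b ^ h" for h s
  proof -
    have "s * b ^ (m - h) \<le> b ^ h * b ^ (m - h)" using that by (intro mult_right_mono) auto
    then show ?thesis using that by (simp flip: power_add)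
  qed
  \<comment> \<open>Divisibility of \<open>f x\<close> recovers both ends of the interval; its
    length gives the depth, and then its left end gives the index.\<close>
  have inj_f: "inj_on f T"
  proof (rule inj_onI)
    fix x y assume xy: "x \<in> T" "y \<in> T" "f x = f y"
    have "u x \<le> u y" "v x \<le> v y" "u y \<le> u x" "v y \<le> v x"
      using f(1)[OF xy(1), of "u x" "v x"] f(1)[OF xy(2), of "u x" "v x"]
        f(1)[OF xy(1), of "u y" "v y"] f(1)[OF xy(2), of "u y" "v y"] xy(3) by auto
    then have uv: "u x = u y" "v x = v y" by auto
    obtain h s h' s' where eq: "x = (h, s)" "y = (h', s')" by (metis surj_pair)
    have hs: "h \<le> m" "s < b ^ h" "h' \<le> m" "s' < b ^ h'" using xy eq by (auto simp: T_def)
    have lo: "s * b ^ (m - h) = s' * b ^ (m - h')"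
      using uv(1) left_end[OF hs(1,2)] left_end[OF hs(3,4)] eq by (simp add: u_def)
    then have "b ^ (m - h) = b ^ (m - h')"
      using uv(2) eq by (simp add: v_def)
    then have "m - h = m - h'" by (simp add: b_def)
    then show "x = y" using lo eq hs by (auto simp: b_def)
  qed
  define S where "S = f ` T"
  define H where "H = (S, {e. \<exists>a l. \<exists>d\<in>{p ^ i * q ^ j | i j. True}.
      (\<exists>n. \<exists>b\<in>{0}. a = b + n * d) \<and> e = {a + n * d | n. n \<le> l} \<inter> S})"
  have H_in: "H \<in> AP_hypergraphs {p ^ i * q ^ j | i j. True} {0}"
    using finT by (simp add: AP_hypergraphs_def H_def S_def verts_def edges_def)
  have "False" if c: "polychromatic_coloring k (delete_small_edges H m) c" for c
  proof -
    have two_colors: "(\<exists>x\<in>X. c (f x) = 0) \<and> (\<exists>x\<in>X. c (f x) = 1)"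
      if X: "X \<subseteq> T" "m \<le> card X" "f ` X \<in> edges H" for X
    proof -
      have "card (f ` X) = card X" using inj_f X(1) by (metis card_image inj_on_subset)
      then have "f ` X \<in> edges (delete_small_edges H m)"
        using X by (simp add: delete_small_edges_def edges_def)
      then have "\<forall>i<k. \<exists>y\<in>f ` X. c y = i" using c unfolding polychromatic_coloring_def by blast
      then show ?thesis using k by auto
    qed
    have edge: "{x \<in> S. n * (p ^ i * q ^ j) \<le> x \<and> x \<le> n * (p ^ i * q ^ j) + l * (p ^ i * q ^ j) \<and>
        p ^ i * q ^ j dvd x} \<in> edges H" (is "?E \<in> _") for n l i j
    proof -
      have "x \<in> {n * (p ^ i * q ^ j) + n' * (p ^ i * q ^ j) | n'. n' \<le> l} \<longleftrightarrow>
          n * (p ^ i * q ^ j) \<le> x \<and> x \<le> n * (p ^ i * q ^ j) + l * (p ^ i * q ^ j) \<and>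
          p ^ i * q ^ j dvd x" for x
        using AP_trace_iff[of "n * (p ^ i * q ^ j)" 0 n "p ^ i * q ^ j" x l] pq
        by (simp flip: of_nat_power of_nat_mult)
      then have "?E = {n * (p ^ i * q ^ j) + n' * (p ^ i * q ^ j) | n'. n' \<le> l} \<inter> S" by blast
      moreover have "n * (p ^ i * q ^ j) = 0 + n * (p ^ i * q ^ j)" by simp
      ultimately show ?thesis unfolding H_def edges_def snd_conv by blast
    qed
    \<comment> \<open>All colors other than 0 are merged; \<open>two_colors\<close> guarantees that
      both resulting classes meet every large edge.\<close>
    define col where "col h s \<longleftrightarrow> c (f (h, s)) = 0" for h s
    have "\<exists>j<b. col (Suc h) (s * b + j) = col 0 0" if hs: "h < m" "s < b ^ h" for h s
    proof -
      define X where "X = (\<lambda>j. (Suc h, s * b + j)) ` {..<b}"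
      have X_eq: "X = {x \<in> T. r x = prod_encode (Suc h, s)}"
      proof (intro set_eqI iffI)
        fix x assume "x \<in> X"
        then obtain j where j: "j < b" "x = (Suc h, s * b + j)" by (auto simp: X_def)
        have "s * b + j < Suc s * b" using j(1) by simp
        also have "\<dots> \<le> b ^ h * b" using hs by (intro mult_right_mono) auto
        finally show "x \<in> {x \<in> T. r x = prod_encode (Suc h, s)}"
          using hs j by (simp add: T_def r_def mult.commute)
      next
        fix x assume "x \<in> {x \<in> T. r x = prod_encode (Suc h, s)}"
        then obtain s' where s': "x = (Suc h, s')" "s' div b = s"
          by (auto simp: r_def split: prod.splits)
        then have "x = (Suc h, s * b + s' mod b)" using div_mult_mod_eq[of s' b] by simp
        then show "x \<in> X" unfolding X_def by (intro image_eqI) (auto simp: b_def)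
      qed
      define n where "n = prod_encode (Suc h, s)"
      have "f ` X = {x \<in> S. B ^ n \<le> x \<and> x < B ^ Suc n}"
        unfolding X_eq S_def n_def[symmetric] using f(2) by auto
      also have "\<dots> = {x \<in> S. B ^ n * (p ^ 0 * q ^ 0) \<le> x \<and>
          x \<le> B ^ n * (p ^ 0 * q ^ 0) + (B ^ Suc n - B ^ n - 1) * (p ^ 0 * q ^ 0) \<and>
          p ^ 0 * q ^ 0 dvd x}" (is "_ = ?R")
      proof -
        \<comment> \<open>A first child witnesses that the window is nonempty, so the truncated
          length \<open>B ^ Suc n - B ^ n - 1\<close> has its intended value.\<close>
        have "(Suc h, s * b + 0) \<in> X" unfolding X_def by (rule imageI) (simp add: b_def)
        then have "B ^ n \<le> f (Suc h, s * b + 0) \<and> f (Suc h, s * b + 0) < B ^ Suc n"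
          unfolding X_eq n_def[symmetric] using f(2) by blast
        then have "B ^ n < B ^ Suc n" by linarith
        then have "x < B ^ Suc n \<longleftrightarrow> x \<le> B ^ n + (B ^ Suc n - B ^ n - 1)" for x by linarith
        then show ?thesis
          unfolding power_0 mult_1_right by (auto simp del: power_Suc)
      qed
      also have "?R \<in> edges H" by (rule edge)
      finally have "f ` X \<in> edges H" .
      moreover have "card X = b" unfolding X_def by (subst card_image) (auto simp: inj_on_def)
      ultimately have "(\<exists>x\<in>X. c (f x) = 0) \<and> (\<exists>x\<in>X. c (f x) = 1)"
        by (intro two_colors) (auto simp: X_eq b_def)
      then have "(\<exists>j<b. col (Suc h) (s * b + j)) \<and> (\<exists>j<b. \<not> col (Suc h) (s * b + j))"
        unfolding X_def col_def by force
      then show ?thesis by metis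
    qed
    then obtain s where s: "s < b ^ m" "\<forall>h\<le>m. col h (s div b ^ (m - h)) = col 0 0"
      using ex_path_same_color[of m b col m] by blast
    define X where "X = (\<lambda>h. (h, s div b ^ (m - h))) ` {..m}"
    \<comment> \<open>An interval contains the leaf \<open>s\<close> iff its left end is at most
      \<open>s\<close> and its right end at least \<open>s + 1\<close>. Measuring the left end from
      \<open>b ^ m\<close> turns both conditions into lower bounds on exponents, hence into
      divisibility by a single \<open>d\<close>.\<close>
    have X_eq: "X = {x \<in> T. b ^ m - s \<le> u x \<and> Suc s \<le> v x}"
    proof (intro set_eqI iffI)
      fix x assume "x \<in> X"
      then obtain h where h: "h \<le> m" "x = (h, s div b ^ (m - h))" by (auto simp: X_def)
      have "s < b ^ h * b ^ (m - h)" using s(1) h by (simp flip: power_add)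
      then have "s div b ^ (m - h) < b ^ h" by (rule less_mult_imp_div_less)
      moreover have "s div b ^ (m - h) * b ^ (m - h) \<le> s" by simp
      moreover have "s < Suc (s div b ^ (m - h)) * b ^ (m - h)"
        by (rule div_less_iff_less_mult[THEN iffD1]) (auto simp: b_def)
      ultimately show "x \<in> {x \<in> T. b ^ m - s \<le> u x \<and> Suc s \<le> v x}"
        using h by (simp add: T_def u_def v_def diff_le_mono2 del: mult_Suc)
    next
      fix x assume "x \<in> {x \<in> T. b ^ m - s \<le> u x \<and> Suc s \<le> v x}"
      moreover obtain h s' where x: "x = (h, s')" by (metis surj_pair)
      ultimately have hs: "h \<le> m" "s' < b ^ h" "b ^ m - s \<le> b ^ m - s' * b ^ (m - h)"
        "s < Suc s' * b ^ (m - h)" by (auto simp: T_def u_def v_def)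
      have "s' * b ^ (m - h) \<le> s" using hs(3) left_end[OF hs(1,2)] s(1) by linarith
      then have "s div b ^ (m - h) = s'"
        using hs(4) by (intro div_nat_eqI) (simp_all add: mult.commute)
      then show "x \<in> X" using x hs(1) by (auto simp: X_def)
    qed
    define d where "d = p ^ (b ^ m - s) * q ^ Suc s"
    have d_pos: "0 < d" using pq by (simp add: d_def)
    have "f ` X = {x \<in> S. d dvd x}"
      unfolding X_eq S_def d_def using f(1) by blast
    \<comment> \<open>A progression from 0 with \<open>\<Sum>S\<close> steps reaches past every
      vertex, so it collects all multiples of \<open>d\<close> in \<open>S\<close>.\<close>
    also have "\<dots> = {x \<in> S. 0 * d \<le> x \<and> x \<le> 0 * d + (\<Sum>S) * d \<and> d dvd x}"
    proof -
      have "x \<le> \<Sum>S * d" if "x \<in> S" for x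
      proof -
        have "x \<le> \<Sum>S" using that finT by (intro member_le_sum) (auto simp: S_def)
        then show ?thesis using d_pos mult_le_mono2[of 1 d "\<Sum>S"] by linarith
      qed
      then show ?thesis by auto
    qed
    also have "\<dots> \<in> edges H" unfolding d_def by (rule edge)
    finally have "f ` X \<in> edges H" .
    moreover have "card X = Suc m" unfolding X_def by (subst card_image) (auto simp: inj_on_def)
    ultimately have "(\<exists>x\<in>X. c (f x) = 0) \<and> (\<exists>x\<in>X. c (f x) = 1)"
      by (intro two_colors) (auto simp: X_eq)
    then obtain h h' where "h \<le> m" "h' \<le> m" "col h (s div b ^ (m - h))"
      "\<not> col h' (s div b ^ (m - h'))"
      unfolding X_def col_def by force
    then show False using s(2) by metis
  qed
  then show ?thesis using H_in by blast
qed

lemma min_edge_size_AP_two_bases: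
  fixes p q k :: nat
  assumes "2 \<le> k" "1 < p" "1 < q" "coprime p q"
  shows "min_edge_size (AP_hypergraphs {p ^ i * q ^ j | i j. True} {0}) k = \<infinity>"
  using min_edge_size_attained ex_AP_hypergraph_not_polychromatic[OF assms] by metis

theorem theorem7:
  fixes k :: nat
  assumes "0 < k"
  shows "(\<forall>(t::nat) (M::nat set).
            2 \<le> t \<longrightarrow> (\<forall>x\<in>M. \<forall>y\<in>M. [x = y] (mod t) \<longrightarrow> x = y) \<longrightarrow>
            min_edge_size (AP_hypergraphs {t ^ i | i. True} M) k
              \<le> enat (card M) * (min_edge_size bottomless_hypergraphs k - 1) + 1)
       \<and> (2 \<le> k \<longrightarrow> (\<forall>(p::nat) (q::nat). 1 < p \<longrightarrow> 1 < q \<longrightarrow> coprime p q \<longrightarrow>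
            min_edge_size (AP_hypergraphs {p ^ i * q ^ j | i j. True} {0}) k = \<infinity>))"
  using min_edge_size_AP_power_le[OF assms] min_edge_size_AP_two_bases by blast

end
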